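(* Let $\mathbb{K}$ be a field of characteristic zero and let $\mathcal{A}$ be a supersolvable line arrangement in $\mathbf{P}^2_{\mathbb{K}}$. Then $n_2(\mathcal{A}) \ge \frac{|\mathcal{A}|}{2}$.
   Context: A line arrangement $\mathcal{A}$ in $\mathbf{P}^2_{\mathbb{K}}$ is a finite set of lines (equivalently, of $2$-dimensional linear subspaces of $\mathbb{K}^3$). Standing assumption: $\mathcal{A}$ is essential, i.e. the lines of $\mathcal{A}$ do not all pass through one common point. $L_2(\mathcal{A})$ denotes the set of points of $\mathbf{P}^2$ which are intersections of at least two lines of $\mathcal{A}$. For $p\in L_2(\mathcal{A})$ put $\mathcal{A}_p=\{H\in\mathcal{A}\mid p\in H\}$ and $\mu(p)=|\mathcal{A}_p|-1$; $p$ is a double point if $\mu(p)=1$. $n_2(\mathcal{A})$ is the number of double points of $\mathcal{A}$. $\mathcal{A}$ is supersolvable if there is a point $p\in L_2(\mathcal{A})$ (a modular point) such that for all distinct $H,L\in\mathcal{A}\setminus\mathcal{A}_p$ there is a unique $K\in\mathcal{A}_p$ with $H\cap L\subset K$. *)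

theory Defs
  imports "HOL-Analysis.Analysis"
begin

text \<open>Points and lines of the projective plane \<open>P\<^sup>2\<close> over the field \<open>'a\<close> are the linear
  subspaces of \<open>'a ^ 3\<close> of dimension 1 and 2, represented by their carrier sets.  Incidence
  of a point with a line is therefore inclusion \<open>\<subseteq>\<close>, not membership.\<close>

definition proj_point :: "('a::field ^ 3) set \<Rightarrow> bool" where
  "proj_point p \<longleftrightarrow> vec.subspace p \<and> vec.dim p = 1"

definition proj_line :: "('a::field ^ 3) set \<Rightarrow> bool" where
  "proj_line H \<longleftrightarrow> vec.subspace H \<and> vec.dim H = 2"

definition line_arrangement :: "('a::field ^ 3) set set \<Rightarrow> bool" where
  "line_arrangement \<A> \<longleftrightarrow> finite \<A> \<and> (\<forall>H\<in>\<A>. proj_line H)"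

definition essential :: "('a::field ^ 3) set set \<Rightarrow> bool" where
  "essential \<A> \<longleftrightarrow> \<not> (\<exists>p. proj_point p \<and> (\<forall>H\<in>\<A>. p \<subseteq> H))"

definition L2 :: "('a::field ^ 3) set set \<Rightarrow> ('a ^ 3) set set" where
  "L2 \<A> = {p. proj_point p \<and> (\<exists>H\<in>\<A>. \<exists>L\<in>\<A>. H \<noteq> L \<and> p = H \<inter> L)}"

definition lines_through :: "('a::field ^ 3) set set \<Rightarrow> ('a ^ 3) set \<Rightarrow> ('a ^ 3) set set" where
  "lines_through \<A> p = {H \<in> \<A>. p \<subseteq> H}"

definition mu :: "('a::field ^ 3) set set \<Rightarrow> ('a ^ 3) set \<Rightarrow> nat" where
  "mu \<A> p = card (lines_through \<A> p) - 1"

definition n2 :: "('a::field ^ 3) set set \<Rightarrow> nat" where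
  "n2 \<A> = card {p \<in> L2 \<A>. mu \<A> p = 1}"

definition modular_point :: "('a::field ^ 3) set set \<Rightarrow> ('a ^ 3) set \<Rightarrow> bool" where
  "modular_point \<A> p \<longleftrightarrow> p \<in> L2 \<A> \<and>
     (\<forall>H \<in> \<A> - lines_through \<A> p. \<forall>L \<in> \<A> - lines_through \<A> p.
        H \<noteq> L \<longrightarrow> (\<exists>!K. K \<in> lines_through \<A> p \<and> H \<inter> L \<subseteq> K))"

definition supersolvable :: "('a::field ^ 3) set set \<Rightarrow> bool" where
  "supersolvable \<A> \<longleftrightarrow> (\<exists>p. modular_point \<A> p)"

end

theory Submission
  imports Defs "HOL-Computational_Algebra.Polynomial"
begin

text \<open>
  Let \<open>p\<close> be a modular point, \<open>m\<close> the number of lines through \<open>p\<close> and \<open>n\<close> the number of remaining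
  lines.  Every point on a remaining line \<open>H\<close> that lies on another line is one of the \<open>m\<close>
  intersections of \<open>H\<close> with the pencil at \<open>p\<close>, so at least \<open>m - (n - 1)\<close> of these are double.
  Moreover \<open>H\<close> always carries a double point, so that there are at least
  \<open>n * max 1 (m + 1 - n) \<ge> (m + n) / 2\<close> double points.

  For the existence of a double point on \<open>H\<close>, send \<open>p\<close> to infinity so that the pencil becomes
  \<open>x = v\<close> for \<open>v \<in> C\<close>, with the line at infinity outside the arrangement; the other lines are
  graphs \<open>y = f(x)\<close>, and \<open>H\<close> may be taken to be \<open>y = 0\<close>.  Let \<open>P\<close> be the product of the \<open>x - v\<close>.
  There is a vector field \<open>P \<partial>\<^sub>x + c(x, y) \<partial>\<^sub>y\<close> tangent to all lines such that \<open>c - y x\<^bsup>m-1\<^esup>\<close>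
  has total degree at most \<open>m - 1\<close>.  Then \<open>c = y e\<close>, and \<open>e(x, 0)\<close> is monic of degree
  \<open>m - 1\<close>.  If no point of \<open>H\<close> were double, tangency to a second line through
  \<open>(v, 0)\<close> would force \<open>e(v, 0) = P'(v)\<close> for all \<open>v \<in> C\<close>, hence \<open>e(x, 0) = P'\<close>, whose
  leading coefficient is \<open>m\<close>; in characteristic zero this contradicts \<open>m \<ge> 2\<close>.
\<close>

section \<open>Bivariate polynomials and total degree\<close>

text \<open>The outer variable is y and the inner one x, so \<open>coeff (coeff q k) j\<close>
  belongs to the monomial \<open>x^j y^k\<close>. A bound by vanishing coefficients needs no
  convention for the zero polynomial.\<close>

definition total_degree_le :: "'a::zero poly poly \<Rightarrow> nat \<Rightarrow> bool" where
  "total_degree_le q N \<longleftrightarrow> (\<forall>j k. N < j + k \<longrightarrow> coeff (coeff q k) j = 0)"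

lemma total_degree_le_add:
  fixes p q :: "'a::comm_semiring_0 poly poly"
  assumes "total_degree_le p N" "total_degree_le q N"
  shows "total_degree_le (p + q) N"
  using assms by (simp add: total_degree_le_def)

lemma total_degree_le_mult:
  fixes p q :: "'a::comm_semiring_0 poly poly"
  assumes p: "total_degree_le p M" and q: "total_degree_le q N"
  shows "total_degree_le (p * q) (M + N)"
  unfolding total_degree_le_def
proof (intro allI impI)
  fix j k assume jk: "M + N < j + k"
  have "coeff (coeff p i) l * coeff (coeff q (k - i)) (j - l) = 0" if "i \<le> k" "l \<le> j" for i l
  proof (cases "M < l + i")
    case True
    then show ?thesis using p by (simp add: total_degree_le_def)
  next
    case False
    then have "N < (j - l) + (k - i)" using jk that by linarith
    then show ?thesis using q by (simp add: total_degree_le_def)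
  qed
  then show "coeff (coeff (p * q) k) j = 0"
    by (auto simp: coeff_mult coeff_sum intro!: sum.neutral)
qed

lemma total_degree_le_prod:
  fixes q :: "'b \<Rightarrow> 'a::comm_semiring_1 poly poly"
  assumes "finite S" "\<And>s. s \<in> S \<Longrightarrow> total_degree_le (q s) 1"
  shows "total_degree_le (\<Prod>s\<in>S. q s) (card S)"
  using assms
proof (induction S rule: finite_induct)
  case empty
  then show ?case by (auto simp: total_degree_le_def coeff_pCons split: nat.splits)
next
  case (insert s S)
  then show ?case using total_degree_le_mult[of "q s" 1 "\<Prod>s\<in>S. q s" "card S"] by simp
qed

lemma total_degree_le_linear:
  fixes f :: "'a::comm_ring_1 poly"
  assumes "degree f \<le> 1"
  shows "total_degree_le [:- f, 1:] 1"
  using assms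
  by (auto simp: total_degree_le_def coeff_pCons coeff_eq_0 split: nat.splits)

text \<open>Substituting a linear \<open>f\<close> for y turns \<open>x^j y^k\<close> into a
  polynomial in x of degree at most \<open>j + k\<close>.\<close>

lemma degree_poly_total_degree_le:
  fixes q :: "'a::idom poly poly"
  assumes q: "total_degree_le q N" and f: "degree f \<le> 1"
  shows "degree (poly q f) \<le> N"
  unfolding poly_altdef
proof (rule degree_sum_le)
  show "finite {..degree q}" by simp
next
  fix k
  show "degree (coeff q k * f ^ k) \<le> N"
  proof (cases "coeff q k = 0")
    case False
    then have "coeff (coeff q k) (degree (coeff q k)) \<noteq> 0" by simp
    then have 1: "degree (coeff q k) + k \<le> N"
      using q unfolding total_degree_le_def by (meson not_le)
    have "degree (f ^ k) \<le> degree f * k" by (rule degree_power_le)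
    also have "\<dots> \<le> k" using mult_le_mono1[OF f, of k] by simp
    finally show ?thesis using 1 degree_mult_le[of "coeff q k" "f ^ k"] by linarith
  qed simp
qed

section \<open>Linear factors and polynomials of degree at most one\<close>

text \<open>The product over the other points has order 0 at \<open>v\<close>, so the whole
  multiplicity of \<open>N\<close> at \<open>v\<close> sits in the cofactor.\<close>

lemma prod_linear_power_dvd:
  fixes N :: "'a::field poly"
  assumes "finite C" "\<And>v. v \<in> C \<Longrightarrow> [:- v, 1:] ^ k v dvd N"
  shows "(\<Prod>v\<in>C. [:- v, 1:] ^ k v) dvd N"
  using assms
proof (induction C rule: finite_induct)
  case (insert v C)
  let ?Q = "\<Prod>v\<in>C. [:- v, 1:] ^ k v"
  obtain R where R: "N = ?Q * R" using insert by (auto simp: dvd_def)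
  show ?case
  proof (cases "N = 0")
    case False
    with R have nz: "R \<noteq> 0" "?Q \<noteq> 0" by auto
    have "poly ?Q v \<noteq> 0" using insert.hyps by (auto simp: poly_prod)
    then have "order v ?Q = 0" by (rule order_0I)
    then have "order v N = order v R" using R False by (simp add: order_mult)
    moreover have "k v \<le> order v N" using insert.prems False by (simp add: order_divides)
    ultimately have "[:- v, 1:] ^ k v dvd R" by (simp add: order_divides)
    then show ?thesis using insert.hyps R by (simp add: mult.commute mult_dvd_mono)
  qed simp
qed simp

text \<open>An integral domain is allowed because the coefficients will lie in
  \<open>'a poly\<close>, the roots being graphs \<open>y = g(x)\<close>. Splitting off one root
  leaves the others as roots of the cofactor.\<close>

lemma prod_linear_factors_dvd:
  fixes q :: "'a::idom poly"
  assumes "finite S" "\<And>s. s \<in> S \<Longrightarrow> poly q s = 0"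
  shows "(\<Prod>s\<in>S. [:- s, 1:]) dvd q"
  using assms
proof (induction S arbitrary: q rule: finite_induct)
  case (insert s S)
  then have "[:- s, 1:] dvd q" by (simp add: poly_eq_0_iff_dvd)
  then obtain r where r: "q = [:- s, 1:] * r" ..
  have "poly r x = 0" if "x \<in> S" for x
  proof -
    have "poly q x = 0" "x \<noteq> s" using insert that by auto
    then show ?thesis by (simp add: r)
  qed
  then have "(\<Prod>s\<in>S. [:- s, 1:]) dvd r" by (rule insert.IH)
  then show ?case using insert.hyps r by (simp add: mult_dvd_mono del: mult_pCons_left)
qed simp


lemma degree_le_1E:
  assumes "degree p \<le> 1"
  obtains a b where "p = [:b, a:]"
proof -
  obtain b q where p: "p = pCons b q" by (cases p)
  with assms have "degree q = 0" by (simp split: if_splits)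
  then show thesis using p that by (auto elim: degree_eq_zeroE)
qed

lemma poly_eq_linear:
  fixes g :: "'a::idom poly"
  assumes "degree g \<le> 1"
  shows "g = [:poly g v:] + smult (coeff g 1) [:- v, 1:]" "pderiv g = [:coeff g 1:]"
proof -
  obtain a b where "g = [:a, b:]" using assms by (rule degree_le_1E) 
  then show "g = [:poly g v:] + smult (coeff g 1) [:- v, 1:]" "pderiv g = [:coeff g 1:]"
    by (auto simp: pderiv_pCons)
qed

lemma linear_dvd_of_root:
  fixes g :: "'a::field poly"
  assumes "degree g = 1" "poly g v = 0"
  shows "g dvd [:- v, 1:]"
proof -
  have "g = smult (coeff g 1) [:- v, 1:]" using poly_eq_linear(1)[of g v] assms by simp
  moreover have "coeff g 1 \<noteq> 0" using assms by (metis leading_coeff_0_iff degree_0 zero_neq_one)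
  ultimately show ?thesis by (metis smult_dvd dvd_refl)
qed

section \<open>Interpolation of the tangent vector field\<close>

lemma coeff_prod_linear_top:
  fixes C :: "'a::idom set"
  shows "coeff (\<Prod>v\<in>C. [:- v, 1:]) (card C) = 1" "degree (\<Prod>v\<in>C. [:- v, 1:]) = card C"
proof -
  show d: "degree (\<Prod>v\<in>C. [:- v, 1:]) = card C" by (subst degree_prod_sum_eq) auto
  show "coeff (\<Prod>v\<in>C. [:- v, 1:]) (card C) = 1"
    using lead_coeff_prod[of "\<lambda>v. [:- v, 1:]" C] by (simp add: d)
qed

text \<open>For \<open>f = a x + b\<close> both products have coefficient \<open>a\<close> at
  \<open>x^(card C)\<close>, and these cancel. This is why \<open>y x^(m-1)\<close> is split off
  from the vertical component.\<close>

lemma degree_tangent_value_le: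
  fixes C :: "'a::field set"
  assumes C: "C \<noteq> {}" "finite C" and f: "degree f \<le> 1"
  shows "degree (pderiv f * (\<Prod>v\<in>C. [:- v, 1:]) - f * monom 1 (card C - 1)) \<le> card C - 1"
proof -
  obtain a b where ab: "f = [:b, a:]" using f by (rule degree_le_1E)
  let ?P = "\<Prod>v\<in>C. [:- v, 1:]"
  have m: "card C > 0" using C by (simp add: card_gt_0_iff)
  have "coeff (pderiv f * ?P - f * monom 1 (card C - 1)) i = 0" if "card C - 1 < i" for i
  proof (cases "i = card C")
    case True
    then show ?thesis using m by (simp add: ab pderiv_pCons coeff_prod_linear_top coeff_pCons split: nat.splits)
  next
    case False
    then have "card C < i" using that by linarith
    then have "coeff ?P i = 0" by (simp add: coeff_eq_0 coeff_prod_linear_top)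
    then show ?thesis using \<open>card C < i\<close> m by (auto simp: ab pderiv_pCons coeff_pCons split: nat.splits)
  qed
  then show ?thesis by (intro degree_le) auto
qed

text \<open>In the notation above, the interpolating polynomial is \<open>c - y x\<^bsup>m-1\<^esup>\<close>.  The Newton
  interpolation step needs \<open>\<Prod>(f - g)\<close> to divide the error at \<open>f\<close>: near a point \<open>(v, w)\<close> the field
  can be compared with the radial field \<open>P / (x - v) \<cdot> ((x - v) \<partial>\<^sub>x + (y - w) \<partial>\<^sub>y)\<close>, which is
  tangent to every line through that point.\<close>

lemma tangent_interpolation:
  fixes C :: "'a::field set" and F :: "'a poly set"
  assumes C: "finite C" "C \<noteq> {}" and F: "finite F" "\<And>f. f \<in> F \<Longrightarrow> degree f \<le> 1"
    and meet: "\<And>f g. f \<in> F \<Longrightarrow> g \<in> F \<Longrightarrow> f \<noteq> g \<Longrightarrow> degree (f - g) = 1 \<and> (\<exists>v\<in>C. poly f v = poly g v)"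
  shows "\<exists>c. total_degree_le c (card C - 1) \<and>
    (\<forall>f\<in>F. poly c f = pderiv f * (\<Prod>v\<in>C. [:- v, 1:]) - f * monom 1 (card C - 1))"
  using F meet
proof (induction F rule: finite_induct)
  case empty
  show ?case by (rule exI[of _ 0]) (simp add: total_degree_le_def)
next
  case (insert f F)
  let ?m = "card C - 1"
  define P where "P = (\<Prod>v\<in>C. [:- v, 1:])"
  define G where "G g = pderiv g * P - g * monom 1 ?m" for g
  obtain c where c: "total_degree_le c ?m" and cF: "\<And>g. g \<in> F \<Longrightarrow> poly c g = G g"
    using insert unfolding G_def P_def by blast
  have dF: "degree g \<le> 1" if "g \<in> F" for g using insert.prems that by auto
  have df: "degree f \<le> 1" using insert.prems by auto
  have "\<forall>g\<in>F. \<exists>v. v \<in> C \<and> poly f v = poly g v"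
    using insert.prems(2)[of f] insert.hyps by blast
  \<comment> \<open>\<open>r g\<close> is the abscissa of the point where the new graph
    \<open>f\<close> meets the old graph \<open>g\<close>.\<close>
  then obtain r where r: "\<And>g. g \<in> F \<Longrightarrow> r g \<in> C \<and> poly f (r g) = poly g (r g)"
    by (auto simp: bchoice_iff)
  have deg1: "degree (f - g) = 1" if "g \<in> F" for g
    using insert.prems(2)[of f g] insert.hyps that by auto
  define Z where "Z = (\<Prod>g\<in>F. [:- g, 1:])"
  define N where "N = G f - poly c f"
  have "[:- v, 1:] ^ card {g \<in> F. r g = v} dvd N" if v: "v \<in> C" for v
  proof -
    let ?F = "{g \<in> F. r g = v}"
    define T where "T = (\<Prod>v\<in>C - {v}. [:- v, 1:])"
    \<comment> \<open>Vertical component of the field built so far minus that of the radial field at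
      \<open>(v, poly f v)\<close>. On every graph through that point it equals the interpolation
      error.\<close>
    define D where "D = c + [:0, monom 1 ?m:] - [:- [:poly f v:], 1:] * [:T:]"
    have P: "P = [:- v, 1:] * T" unfolding P_def T_def using v C by (simp add: prod.remove)
    have D: "poly D g = poly c g - G g" if "degree g \<le> 1" "poly g v = poly f v" for g
    proof -
      have "g - [:poly f v:] = smult (coeff g 1) [:- v, 1:]"
        using poly_eq_linear(1)[OF that(1), of v] that(2) by (simp add: algebra_simps)
      then have "(g - [:poly f v:]) * T = pderiv g * P"
        by (simp add: P poly_eq_linear(2)[OF that(1)] del: mult_pCons_left)
      then show ?thesis by (simp add: D_def G_def algebra_simps)
    qed
    have "poly D g = 0" if "g \<in> ?F" for g
      using that D[of g] dF cF r by force
    \<comment> \<open>The error vanishes on the old graphs through the point, so \<open>D\<close> is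
      divisible by the product of the \<open>y - g\<close>; setting \<open>y = f\<close> bounds the
      error at \<open>f\<close> from below in multiplicity.\<close>
    then have "(\<Prod>g\<in>?F. [:- g, 1:]) dvd D"
      using insert.hyps by (intro prod_linear_factors_dvd) auto
    then obtain R where "D = (\<Prod>g\<in>?F. [:- g, 1:]) * R" ..
    then have "poly D f = (\<Prod>g\<in>?F. f - g) * poly R f" by (simp add: poly_prod)
    then have "(\<Prod>g\<in>?F. f - g) dvd N" using D[of f] df unfolding N_def
      by (metis dvd_triv_left dvd_diff_commute)
    moreover have "(\<Prod>g\<in>?F. [:- v, 1:]) dvd (\<Prod>g\<in>?F. f - g)"
      by (intro prod_dvd_prod) (use r in \<open>force simp: poly_eq_0_iff_dvd[symmetric]\<close>)
    ultimately show ?thesis by (simp add: dvd_trans)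
  qed
  then have "(\<Prod>v\<in>C. [:- v, 1:] ^ card {g \<in> F. r g = v}) dvd N"
    using C by (intro prod_linear_power_dvd)
  moreover have "(\<Prod>v\<in>C. [:- v, 1:] ^ card {g \<in> F. r g = v}) = (\<Prod>g\<in>F. [:- r g, 1:])"
    using prod.group[of F C r "\<lambda>g. [:- r g, 1:]"] insert.hyps C r by (auto simp: image_subset_iff)
  \<comment> \<open>Each \<open>f - g\<close> is linear with root \<open>r g\<close>, so it is a
    unit times \<open>x - r g\<close>.\<close>
  moreover have "poly Z f dvd (\<Prod>g\<in>F. [:- r g, 1:])"
    unfolding Z_def poly_prod
  proof (rule prod_dvd_prod)
    fix g assume g: "g \<in> F"
    then have "f - g dvd [:- r g, 1:]"
      using r by (intro linear_dvd_of_root deg1) auto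
    then show "poly [:- g, 1:] f dvd [:- r g, 1:]" by simp
  qed
  ultimately have "poly Z f dvd N" using dvd_trans by metis
  then obtain q where q: "N = poly Z f * q" ..
  have degZ: "degree (poly Z f) = card F"
    unfolding Z_def poly_prod using deg1 by (subst degree_prod_sum_eq) fastforce+
  have Znz: "poly Z f \<noteq> 0"
    unfolding Z_def poly_prod using insert.hyps by auto
  have degN: "degree N \<le> ?m"
    unfolding N_def G_def P_def
    by (intro degree_diff_le degree_tangent_value_le degree_poly_total_degree_le c df C)
  \<comment> \<open>The Newton correction \<open>q Z\<close> vanishes on all old graphs. If
    \<open>card F\<close> exceeds \<open>?m\<close>, the bound on \<open>degree N\<close> forces
    \<open>q = 0\<close>.\<close>
  have qZ: "total_degree_le ([:q:] * Z) ?m"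
  proof (cases "q = 0")
    case False
    then have "degree q + card F \<le> ?m" using degN q degZ Znz by (simp add: degree_mult_eq)
    moreover have "total_degree_le [:q:] (?m - card F)"
      using calculation by (auto simp: total_degree_le_def coeff_pCons coeff_eq_0 split: nat.splits)
    moreover have "total_degree_le Z (card F)"
      unfolding Z_def using insert.hyps dF by (intro total_degree_le_prod total_degree_le_linear) auto
    ultimately show ?thesis using total_degree_le_mult by (metis add_leD2 le_add_diff_inverse2)
  qed (simp add: total_degree_le_def)
  have "poly (c + [:q:] * Z) g = G g" if "g \<in> insert f F" for g
  proof (cases "g = f")
    case True
    then show ?thesis using q by (simp add: N_def algebra_simps)
  next
    case False
    then have "g \<in> F" using that by simp
    moreover have "poly Z g = 0" unfolding Z_def poly_prod
      using \<open>g \<in> F\<close> insert.hyps by (auto intro!: prod_zero bexI[of _ g])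
    ultimately show ?thesis by (simp add: cF)
  qed
  then show ?case
    using total_degree_le_add[OF c qZ] unfolding G_def P_def by blast
qed

text \<open>The pencil is encoded by its abscissas \<open>C\<close>, the other lines by their
  equations \<open>F\<close>, and the chosen line by \<open>0\<close>.\<close>

lemma zero_section_has_double_point:
  fixes C :: "'a::field_char_0 set" and F :: "'a poly set"
  assumes C: "finite C" "2 \<le> card C" and F: "finite F" "\<And>f. f \<in> F \<Longrightarrow> degree f \<le> 1"
    and meet: "\<And>f g. f \<in> F \<Longrightarrow> g \<in> F \<Longrightarrow> f \<noteq> g \<Longrightarrow> degree (f - g) = 1 \<and> (\<exists>v\<in>C. poly f v = poly g v)"
    and 0: "0 \<in> F"
  shows "\<exists>v\<in>C. \<forall>f\<in>F. f \<noteq> 0 \<longrightarrow> poly f v \<noteq> 0"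
proof (rule ccontr)
  assume "\<not> ?thesis"
  then have cover: "\<And>v. v \<in> C \<Longrightarrow> \<exists>f\<in>F. f \<noteq> 0 \<and> poly f v = 0" by blast
  let ?m = "card C - 1"
  define P where "P = (\<Prod>v\<in>C. [:- v, 1:])"
  have "C \<noteq> {}" using C by auto
  then obtain c where c: "total_degree_le c ?m"
    and cF: "\<And>f. f \<in> F \<Longrightarrow> poly c f = pderiv f * P - f * monom 1 ?m"
    using tangent_interpolation[OF C(1) _ F meet] unfolding P_def by blast
  obtain c0 e where ce: "c = pCons c0 e" by (cases c)
  have "c0 = 0" using cF[OF 0] by (simp add: ce)
  define e0 where "e0 = coeff e 0"
  \<comment> \<open>The factor y uses up one degree, so \<open>e0\<close> does not reach the
    coefficient at \<open>?m\<close>.\<close>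
  have "coeff e0 j = 0" if "?m \<le> j" for j
    using c that unfolding total_degree_le_def ce e0_def
    by (metis coeff_pCons_Suc One_nat_def less_add_one order_le_less_trans Suc_eq_plus1 add_0)
  note e0 = this
  \<comment> \<open>Since \<open>y x^(m-1)\<close> was split off from the field, the restriction of
    its vertical component divided by y is \<open>monom 1 ?m + e0\<close>; \<open>W\<close> is its
    distance from \<open>P'\<close>.\<close>
  define W where "W = pderiv P - monom 1 ?m - e0"
  have degP: "degree P = card C" "coeff P (card C) = 1" unfolding P_def by (simp_all add: coeff_prod_linear_top)
  have "poly W v = 0" if v: "v \<in> C" for v
  proof -
    obtain f where f: "f \<in> F" "f \<noteq> 0" "poly f v = 0" using cover v by blast
    define a where "a = coeff f 1"
    have fa: "f = smult a [:- v, 1:]" "pderiv f = [:a:]"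
      using poly_eq_linear(1)[of f v] poly_eq_linear(2)[of f] F f unfolding a_def by auto
    define T where "T = (\<Prod>v\<in>C - {v}. [:- v, 1:])"
    have P: "P = [:- v, 1:] * T" unfolding P_def T_def using v C by (simp add: prod.remove)
    \<comment> \<open>As \<open>f\<close> is a multiple of \<open>x - v\<close>, it cancels from the
      tangency equation; the remaining \<open>T\<close> agrees with \<open>P'\<close> at
      \<open>v\<close>.\<close>
    have "pderiv f * P = f * T" unfolding fa(2) P by (subst fa(1)) (simp add: smult_diff_right)
    then have "f * poly e f = f * (T - monom 1 ?m)"
      using cF[OF f(1)] unfolding ce \<open>c0 = 0\<close> by (simp add: algebra_simps)
    then have "poly e f = T - monom 1 ?m" using f(2) by simp
    moreover have "poly (poly e f) v = poly e0 v"
      unfolding e0_def by (cases e) (simp add: f(3))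
    moreover have "poly (pderiv P) v = poly T v"
      unfolding P by (simp add: pderiv_mult pderiv_pCons del: mult_pCons_left)
    ultimately show ?thesis by (simp add: W_def)
  qed
  then have sub: "C \<subseteq> {x. poly W x = 0}" by blast
  \<comment> \<open>This coefficient is \<open>m - 1\<close>, nonzero in characteristic zero, while
    \<open>W\<close> has \<open>m\<close> roots and degree at most \<open>m - 1\<close>.\<close>
  have "coeff W ?m = of_nat (card C) - 1"
    using C degP by (simp add: W_def e0 coeff_pderiv)
  also have "\<dots> = of_nat ?m" using C by (simp add: of_nat_diff)
  finally have "coeff W ?m \<noteq> 0" using C by simp
  then have "W \<noteq> 0" by auto
  have "degree (pderiv P) \<le> ?m" using degP(1) by (simp add: degree_pderiv)
  moreover have "degree e0 \<le> ?m" using e0 by (intro degree_le) auto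
  ultimately have "degree W \<le> ?m"
    unfolding W_def by (intro degree_diff_le) (auto simp: degree_monom_eq)
  moreover have "card C \<le> degree W"
    using card_mono[OF poly_roots_finite[OF \<open>W \<noteq> 0\<close>] sub] card_poly_roots_bound[OF \<open>W \<noteq> 0\<close>]
    by linarith
  ultimately show False using C by linarith
qed

section \<open>Linear algebra of projective points and lines\<close>

lemma subspace_scale_cancel:
  fixes x :: "'a::field ^ 'n"
  assumes "vec.subspace K" "a *s x \<in> K" "a \<noteq> 0"
  shows "x \<in> K"
  using vec.subspace_scale[OF assms(1,2), of "inverse a"] assms(3) by (simp add: vec.scale_scale)

lemma proj_point_subset_eq: "proj_point p \<Longrightarrow> proj_point q \<Longrightarrow> p \<subseteq> q \<Longrightarrow> p = q"
  unfolding proj_point_def by (metis vec.subspace_dim_equal order_refl)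

lemma proj_line_subset_eq: "proj_line H \<Longrightarrow> proj_line K \<Longrightarrow> H \<subseteq> K \<Longrightarrow> H = K"
  unfolding proj_line_def by (metis vec.subspace_dim_equal order_refl)

lemma dim_UNIV_3: "vec.dim (UNIV :: ('a::field ^ 3) set) = 3"
  using vec_dim_card[where 'a = 'a and 'n = 3] by simp

lemma span_eq_UNIV_of_dim_3:
  fixes S :: "('a::field ^ 3) set"
  assumes "vec.dim S = 3"
  shows "vec.span S = UNIV"
  using assms vec.dim_eq_full[of S] dim_UNIV_3[where 'a = 'a]
  by (simp add: vec.dimension_def del: vec_dim_card)

text \<open>\<open>L\<close> and \<open>u\<close> together span the space, so any vector can be
  moved into \<open>L\<close> along \<open>u\<close>.\<close>

lemma proj_line_exchange:
  fixes u w :: "'a::field ^ 3"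
  assumes L: "proj_line L" and u: "u \<notin> L"
  shows "\<exists>a. w + a *s u \<in> L"
proof -
  have span: "vec.span L = L" using L by (simp add: proj_line_def vec.span_eq_iff)
  have "vec.dim (insert u L) = 3"
    using L u by (simp add: vec.dim_insert span proj_line_def)
  then have "w \<in> vec.span (insert u L)" using span_eq_UNIV_of_dim_3 by blast
  then obtain a where "w - a *s u \<in> L" unfolding vec.span_insert span by blast
  then show ?thesis by (intro exI[of _ "- a"]) (simp add: vec.scale_minus_left)
qed

lemma proj_point_nonzero:
  assumes "proj_point p"
  obtains u where "u \<in> p" "u \<noteq> 0" "p = vec.span {u}"
proof -
  have s: "vec.subspace p" "vec.dim p = 1" using assms by (auto simp: proj_point_def)
  then have "\<not> p \<subseteq> {0}" using vec.dim_eq_0[of p] by simp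
  then obtain u where u: "u \<in> p" "u \<noteq> 0" by auto
  have "vec.span {u} \<subseteq> p" using u s by (simp add: vec.span_minimal)
  then have "vec.span {u} = p"
    using s u by (intro vec.subspace_dim_equal) auto
  then show thesis using that u by blast
qed

lemma proj_line_Int:
  assumes H: "proj_line H" and L: "proj_line L" and ne: "H \<noteq> L"
  shows "proj_point (H \<inter> L)"
proof -
  have sub: "vec.subspace H" "vec.subspace L" "vec.dim H = 2" "vec.dim L = 2"
    using H L by (auto simp: proj_line_def)
  then have sI: "vec.subspace (H \<inter> L)" by (simp add: vec.subspace_inter)
  obtain l where l: "l \<in> L" "l \<notin> H" using proj_line_subset_eq[OF L H] ne by blast
  have "\<not> L \<subseteq> vec.span {l}"
    using vec.dim_mono[of L "{l}"] sub by (auto split: if_splits)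
  then obtain k where k: "k \<in> L" "k \<notin> vec.span {l}" by blast
  obtain a where a: "k + a *s l \<in> H" using proj_line_exchange[OF H l(2)] by blast
  have "k + a *s l \<noteq> 0"
  proof
    assume "k + a *s l = 0"
    then have "k = (- a) *s l" by (simp add: eq_neg_iff_add_eq_0 vec.scale_minus_left)
    then show False using k by (metis vec.span_base vec.span_scale singletonI)
  qed
  moreover have "k + a *s l \<in> H \<inter> L"
    using a k l sub by (simp add: vec.subspace_add vec.subspace_scale)
  ultimately have "vec.dim (H \<inter> L) \<noteq> 0" unfolding vec.dim_eq_0 by blast
  moreover have "vec.dim (H \<inter> L) < vec.dim L"
    using l sub sI by (intro vec.dim_psubset) (auto simp: vec.span_eq_iff[THEN iffD2])
  ultimately show ?thesis using sI sub by (auto simp: proj_point_def simp del: vec.dim_eq_0)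
qed

section \<open>Affine coordinates adapted to the pencil\<close>

text \<open>The span of \<open>u\<close> and \<open>w\<close> serves as line at infinity outside the
  pencil. A pencil line containing \<open>v1 + l *s v2\<close> for two values of \<open>l\<close>
  would contain a basis, so finitely many \<open>l\<close> are excluded in an infinite
  field.\<close>

lemma pencil_coordinates:
  fixes S :: "('a::field_char_0 ^ 3) set set"
  assumes S: "finite S" "\<And>K. K \<in> S \<Longrightarrow> proj_line K \<and> u \<in> K" and u: "u \<noteq> 0"
  obtains w t where "\<And>K. K \<in> S \<Longrightarrow> w \<notin> K"
    and "\<And>x. \<exists>\<alpha> \<beta> \<gamma>. x = \<alpha> *s u + \<beta> *s w + \<gamma> *s t"
proof -
  have "\<exists>x. x \<notin> vec.span B" if "finite B" "card B < 3" for B :: "('a ^ 3) set"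
    using vec.dim_le_card[of UNIV B] that dim_UNIV_3[where 'a = 'a]
    by (fastforce simp del: vec.dim_UNIV)
  note outside = this
  obtain v1 where v1: "v1 \<notin> vec.span {u}" using outside[of "{u}"] by auto
  obtain v2 where v2: "v2 \<notin> vec.span {v1, u}"
    using outside[of "{v1, u}"] card_insert_le_m1[of 2 "{u}" v1] by auto
  have dim3: "vec.dim {v2, v1, u} = 3"
    using u v1 v2 by (simp add: vec.dim_insert)
  then have span: "vec.span {v2, v1, u} = UNIV" by (rule span_eq_UNIV_of_dim_3)
  have comb: "\<exists>\<alpha> \<beta> \<gamma>. x = \<alpha> *s u + \<beta> *s v1 + \<gamma> *s v2" for x
  proof -
    have "x \<in> vec.span {v2, v1, u}" by (simp add: span)
    then obtain a b c where "x - a *s v2 - b *s v1 = c *s u"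
      by (auto simp: vec.span_insert vec.span_singleton)
    then have "x = c *s u + b *s v1 + a *s v2" by (simp add: algebra_simps)
    then show ?thesis by blast
  qed
  have "finite {l. v1 + l *s v2 \<in> K}" if K: "K \<in> S" for K
  proof (rule ccontr)
    assume inf: "infinite {l. v1 + l *s v2 \<in> K}"
    have sub: "vec.subspace K" "vec.dim K = 2" using S K by (auto simp: proj_line_def)
    obtain l where l: "v1 + l *s v2 \<in> K" using not_finite_existsD[OF inf] by blast
    have "infinite ({l. v1 + l *s v2 \<in> K} - {l})" using inf by simp
    then have "{l. v1 + l *s v2 \<in> K} - {l} \<noteq> {}" by (metis finite.emptyI)
    then obtain l' where l': "v1 + l' *s v2 \<in> K" "l' \<noteq> l" by blast
    have "(v1 + l' *s v2) - (v1 + l *s v2) \<in> K"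
      by (intro vec.subspace_diff sub l l')
    then have "(l' - l) *s v2 \<in> K" by (simp add: vec.scale_left_diff_distrib)
    then have v2K: "v2 \<in> K" using subspace_scale_cancel[OF sub(1)] l' by (metis right_minus_eq)
    then have "(v1 + l *s v2) - l *s v2 \<in> K"
      by (intro vec.subspace_diff vec.subspace_scale sub l v2K)
    then have "{v2, v1, u} \<subseteq> K" using v2K S K by auto
    then show False using vec.dim_subset[of "{v2, v1, u}" K] dim3 sub by simp
  qed
  then have "finite (\<Union>K\<in>S. {l. v1 + l *s v2 \<in> K})" using S by blast
  then obtain l where l: "l \<notin> (\<Union>K\<in>S. {l. v1 + l *s v2 \<in> K})"
    using ex_new_if_finite infinite_UNIV_char_0 by blast
  show thesis
  proof (rule that[of "v1 + l *s v2" v2])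
    fix x
    obtain a b c where "x = a *s u + b *s v1 + c *s v2" using comb by blast
    then have "x = a *s u + b *s (v1 + l *s v2) + (c - b * l) *s v2"
      by (simp add: vec.scale_right_distrib vec.scale_left_diff_distrib)
    then show "\<exists>\<alpha> \<beta> \<gamma>. x = \<alpha> *s u + \<beta> *s (v1 + l *s v2) + \<gamma> *s v2" by blast
  qed (use l in auto)
qed

text \<open>In the chart \<open>t + x *s w + y *s u\<close> the pencil line \<open>K\<close> is
  \<open>x = c K\<close>, and a line \<open>L\<close> missing \<open>p\<close> is the graph of
  \<open>f L\<close>.\<close>

lemma double_point_on_line:
  fixes \<A> :: "('a::field_char_0 ^ 3) set set"
  assumes arr: "line_arrangement \<A>" and mod: "modular_point \<A> p"
    and H: "H \<in> \<A>" "\<not> p \<subseteq> H"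
  shows "\<exists>K\<in>lines_through \<A> p. \<forall>L\<in>\<A>. \<not> p \<subseteq> L \<longrightarrow> L \<noteq> H \<longrightarrow> \<not> H \<inter> K \<subseteq> L"
proof (rule ccontr)
  assume "\<not> ?thesis"
  then have cover: "\<And>K. K \<in> lines_through \<A> p \<Longrightarrow> \<exists>L\<in>\<A>. \<not> p \<subseteq> L \<and> L \<noteq> H \<and> H \<inter> K \<subseteq> L" by blast
  let ?S = "lines_through \<A> p"
  define B where "B = {L \<in> \<A>. \<not> p \<subseteq> L}"
  have fin: "finite \<A>" and pl: "\<And>L. L \<in> \<A> \<Longrightarrow> proj_line L"
    using arr by (auto simp: line_arrangement_def)
  have subsp: "vec.subspace L" if "L \<in> \<A>" for L using pl[OF that] by (simp add: proj_line_def)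
  have p: "p \<in> L2 \<A>" using mod by (simp add: modular_point_def)
  then have "proj_point p" by (simp add: L2_def)
  then obtain u where u: "u \<in> p" "u \<noteq> 0" "p = vec.span {u}" by (rule proj_point_nonzero)
  have pu: "p \<subseteq> L \<longleftrightarrow> u \<in> L" if "L \<in> \<A>" for L
    using u(1) vec.span_minimal[of "{u}" L, folded u(3)] subsp[OF that] by blast
  have S: "K \<in> \<A>" "u \<in> K" if "K \<in> ?S" for K
    using that u by (auto simp: lines_through_def)
  have B: "L \<in> \<A>" "u \<notin> L" if "L \<in> B" for L
    using that pu by (auto simp: B_def)
  have finS: "finite ?S" using fin by (simp add: lines_through_def)
  obtain w t where w: "\<And>K. K \<in> ?S \<Longrightarrow> w \<notin> K"
    and comb: "\<And>x. \<exists>\<alpha> \<beta> \<gamma>. x = \<alpha> *s u + \<beta> *s w + \<gamma> *s t"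
    using pencil_coordinates[of ?S u] finS u S pl by metis
  have "\<exists>x. t + x *s w \<in> K" if K: "K \<in> ?S" for K
  proof -
    have sub: "vec.subspace K" "vec.dim K = 2"
      using pl[OF S(1)[OF K]] by (auto simp: proj_line_def)
    have "\<not> K \<subseteq> vec.span {u}"
      using vec.dim_mono[of K "{u}"] sub by (auto split: if_splits)
    then obtain k where k: "k \<in> K" "k \<notin> vec.span {u}" by blast
    obtain \<alpha> \<beta> \<gamma> where abc: "k = \<alpha> *s u + \<beta> *s w + \<gamma> *s t" using comb by blast
    then have "k - \<alpha> *s u = \<beta> *s w + \<gamma> *s t" by simp
    then have bc: "\<beta> *s w + \<gamma> *s t \<in> K"
      using k S(2)[OF K] sub by (metis vec.subspace_diff vec.subspace_scale)
    have "\<gamma> \<noteq> 0"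
    proof
      assume "\<gamma> = 0"
      then have "\<beta> \<noteq> 0" using abc k by (auto simp: vec.span_singleton)
      moreover have "\<beta> *s w \<in> K" using bc \<open>\<gamma> = 0\<close> by simp
      ultimately show False using subspace_scale_cancel[OF sub(1)] w[OF K] by blast
    qed
    moreover have "inverse \<gamma> *s (\<beta> *s w + \<gamma> *s t) \<in> K"
      using bc sub by (intro vec.subspace_scale)
    ultimately have "t + (inverse \<gamma> * \<beta>) *s w \<in> K"
      by (simp add: vec.scale_right_distrib add.commute)
    then show ?thesis by blast
  qed
  then obtain c where c: "\<And>K. K \<in> ?S \<Longrightarrow> t + c K *s w \<in> K" by metis
  have c_unique: "x = c K" if K: "K \<in> ?S" and x: "t + x *s w \<in> K" for K x
  proof (rule ccontr)
    assume ne: "x \<noteq> c K"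
    have sub: "vec.subspace K" using subsp S K by blast
    have "(t + x *s w) - (t + c K *s w) \<in> K"
      by (intro vec.subspace_diff sub x c K)
    then have "(x - c K) *s w \<in> K" by (simp add: vec.scale_left_diff_distrib)
    then show False using subspace_scale_cancel[OF sub] w[OF K] ne by (metis right_minus_eq)
  qed
  have inj: "inj_on c ?S"
  proof (rule inj_onI)
    fix K K' assume K: "K \<in> ?S" and K': "K' \<in> ?S" and eq: "c K = c K'"
    have "k \<in> K'" if k: "k \<in> K" for k
    proof -
      have sub: "vec.subspace K" "vec.subspace K'" using subsp S K K' by auto
      obtain \<alpha> \<beta> \<gamma> where abc: "k = \<alpha> *s u + \<beta> *s w + \<gamma> *s t" using comb by blast
      then have *: "k = \<alpha> *s u + \<gamma> *s (t + c K *s w) + (\<beta> - \<gamma> * c K) *s w"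
        by (simp add: vec.scale_right_distrib vec.scale_left_diff_distrib)
      have "k - (\<alpha> *s u + \<gamma> *s (t + c K *s w)) \<in> K"
        by (intro vec.subspace_diff vec.subspace_add vec.subspace_scale sub(1) k S(2)[OF K] c[OF K])
      then have "(\<beta> - \<gamma> * c K) *s w \<in> K" by (subst (asm) *) simp
      then have "\<beta> - \<gamma> * c K = 0"
        using subspace_scale_cancel[OF sub(1)] w[OF K] by blast
      then have "k = \<alpha> *s u + \<gamma> *s (t + c K' *s w)" using * eq by simp
      then show ?thesis using sub S(2)[OF K'] c[OF K']
        by (simp only: vec.subspace_add vec.subspace_scale)
    qed
    then show "K = K'" using proj_line_subset_eq[of K K'] pl S K K' by blast
  qed
  have "\<exists>a b. t + b *s u \<in> L \<and> w + a *s u \<in> L" if "L \<in> B" for L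
    using proj_line_exchange[OF pl[OF B(1)[OF that]] B(2)[OF that]] by metis
  then obtain a b where ab: "\<And>L. L \<in> B \<Longrightarrow> t + b L *s u \<in> L \<and> w + a L *s u \<in> L" by metis
  define f where "f L = [:b L, a L:]" for L
  have on_line: "t + x *s w + poly (f L) x *s u \<in> L" if L: "L \<in> B" for L x
  proof -
    have "(t + b L *s u) + x *s (w + a L *s u) \<in> L"
      by (intro vec.subspace_add vec.subspace_scale subsp[OF B(1)[OF L]]
          ab[OF L, THEN conjunct1] ab[OF L, THEN conjunct2])
    then show ?thesis
      by (simp add: f_def vec.scale_right_distrib vec.scale_left_distrib ac_simps)
  qed
  have cancel: "x = y" if L: "L \<in> B" and "v + x *s u \<in> L" "v + y *s u \<in> L" for L v x y
  proof (rule ccontr)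
    assume ne: "x \<noteq> y"
    have sub: "vec.subspace L" using subsp B L by blast
    have "(v + x *s u) - (v + y *s u) \<in> L"
      by (intro vec.subspace_diff sub that)
    then have "(x - y) *s u \<in> L" by (simp add: vec.scale_left_diff_distrib)
    then show False using subspace_scale_cancel[OF sub] B(2)[OF L] ne by (metis right_minus_eq)
  qed
  have meet: "a L \<noteq> a L' \<and> (\<exists>K\<in>?S. poly (f L) (c K) = poly (f L') (c K))"
    if L: "L \<in> B" "L' \<in> B" "L \<noteq> L'" for L L'
  proof -
    have "L \<in> \<A> - ?S" "L' \<in> \<A> - ?S" using L by (auto simp: B_def lines_through_def)
    then obtain K where K: "K \<in> ?S" "L \<inter> L' \<subseteq> K"
      using mod L(3) unfolding modular_point_def by blast
    have sub: "vec.subspace K" using subsp S K by blast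
    \<comment> \<open>Equal slopes mean a common point at infinity; modularity would put it, and
      hence \<open>w\<close>, on a line of the pencil.\<close>
    have ne: "a L \<noteq> a L'"
    proof
      assume "a L = a L'"
      then have "w + a L *s u \<in> K" using ab[OF L(1)] ab[OF L(2)] K by auto
      then have "(w + a L *s u) - a L *s u \<in> K"
        by (intro vec.subspace_diff vec.subspace_scale sub S(2)[OF K(1)])
      then show False using w[OF K(1)] by simp
    qed
    define x where "x = (b L' - b L) / (a L - a L')"
    have "x * (a L - a L') = b L' - b L" using ne by (simp add: x_def)
    then have eq: "poly (f L) x = poly (f L') x" by (simp add: f_def algebra_simps)
    then have "t + x *s w + poly (f L) x *s u \<in> K"
      using on_line[OF L(1), of x] on_line[OF L(2), of x] K by auto
    then have "(t + x *s w + poly (f L) x *s u) - poly (f L) x *s u \<in> K"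
      by (intro vec.subspace_diff vec.subspace_scale sub S(2)[OF K(1)])
    then have "x = c K" using c_unique[OF K(1)] by simp
    then show ?thesis using ne eq K by blast
  qed
  have HB: "H \<in> B" using H by (simp add: B_def)
  \<comment> \<open>The shear by \<open>f H\<close> straightens \<open>H\<close> to
    \<open>y = 0\<close> and preserves all differences of equations.\<close>
  define F where "F = (\<lambda>L. f L - f H) ` B"
  have "\<exists>v\<in>c ` ?S. \<forall>g\<in>F. g \<noteq> 0 \<longrightarrow> poly g v \<noteq> 0"
  proof (rule zero_section_has_double_point)
    show "finite (c ` ?S)" using finS by simp
    obtain K K' where "K \<in> \<A>" "K' \<in> \<A>" "K \<noteq> K'" "p = K \<inter> K'" using p by (auto simp: L2_def)
    then have "{K, K'} \<subseteq> ?S" "card {K, K'} = 2" by (auto simp: lines_through_def)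
    then show "2 \<le> card (c ` ?S)" using card_mono[OF finS] card_image[OF inj] by metis
    show "finite F" using fin by (simp add: F_def B_def)
    show "degree g \<le> 1" if "g \<in> F" for g using that by (auto simp: F_def f_def)
    show "0 \<in> F" using HB by (force simp: F_def)
    show "degree (g - h) = 1 \<and> (\<exists>v\<in>c ` ?S. poly g v = poly h v)"
      if gh: "g \<in> F" "h \<in> F" "g \<noteq> h" for g h
    proof -
      obtain L L' where L: "L \<in> B" "L' \<in> B" "g = f L - f H" "h = f L' - f H"
        using gh by (auto simp: F_def)
      then have "L \<noteq> L'" using gh by auto
      from meet[OF L(1,2) this] obtain K where K: "a L \<noteq> a L'" "K \<in> ?S"
        "poly (f L) (c K) = poly (f L') (c K)" by blast
      have "degree (g - h) = 1" using K(1) by (simp add: L(3,4) f_def)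
      moreover have "poly g (c K) = poly h (c K)" using K(3) by (simp add: L(3,4))
      ultimately show ?thesis using K(2) by blast
    qed
  qed
  then obtain K where K: "K \<in> ?S" and noroot: "\<And>g. g \<in> F \<Longrightarrow> g \<noteq> 0 \<Longrightarrow> poly g (c K) \<noteq> 0" by auto
  obtain L where L: "L \<in> B" "L \<noteq> H" "H \<inter> K \<subseteq> L" using cover[OF K] by (auto simp: B_def)
  have sub: "vec.subspace K" using subsp S K by blast
  have "t + c K *s w + poly (f H) (c K) *s u \<in> K"
    by (intro vec.subspace_add[OF sub] vec.subspace_scale[OF sub] c[OF K] S(2)[OF K])
  then have "t + c K *s w + poly (f H) (c K) *s u \<in> L" using on_line[OF HB] L by blast
  then have "poly (f H) (c K) = poly (f L) (c K)" using cancel[OF L(1)] on_line[OF L(1)] by blast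
  moreover have "f L - f H \<noteq> 0" using meet[OF L(1) HB L(2)] by (auto simp: f_def)
  ultimately show False using noroot[of "f L - f H"] L(1) by (auto simp: F_def)
qed

section \<open>Counting double points\<close>

theorem theorem1p3:
  fixes \<A> :: "('a::field_char_0 ^ 3) set set"
  assumes "line_arrangement \<A>"
    and "essential \<A>"
    and "supersolvable \<A>"
  shows "real (n2 \<A>) \<ge> real (card \<A>) / 2"
proof -
  have fin: "finite \<A>" and pl: "\<And>L. L \<in> \<A> \<Longrightarrow> proj_line L"
    using assms(1) by (auto simp: line_arrangement_def)
  obtain p where mod: "modular_point \<A> p" using assms(3) by (auto simp: supersolvable_def)
  define S where "S = lines_through \<A> p"
  define B where "B = \<A> - S"
  have S: "K \<in> \<A>" "p \<subseteq> K" if "K \<in> S" for K using that by (auto simp: S_def lines_through_def)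
  have B: "L \<in> \<A>" "\<not> p \<subseteq> L" if "L \<in> B" for L using that by (auto simp: B_def S_def lines_through_def)
  have finS: "finite S" and finB: "finite B" using fin by (auto simp: S_def B_def lines_through_def)
  have cardA: "card \<A> = card S + card B"
    unfolding B_def using fin S by (metis card_Diff_subset card_mono finS le_add_diff_inverse subsetI)
  have "p \<in> L2 \<A>" using mod by (simp add: modular_point_def)
  then have pp: "proj_point p" by (simp add: L2_def)
  then have "B \<noteq> {}" using assms(2) by (auto simp: essential_def B_def S_def lines_through_def)
  then have n1: "card B \<ge> 1" using finB by (simp add: Suc_leI card_gt_0_iff)
  have pt: "proj_point (H \<inter> L)" if "H \<in> \<A>" "L \<in> \<A>" "H \<noteq> L" for H L
    using that pl proj_line_Int by blast
  have BS: "H \<noteq> K" if "H \<in> B" "K \<in> S" for H K using B[OF that(1)] S[OF that(2)] by blast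
  \<comment> \<open>Two pencil lines meet only in \<open>p\<close>, which is not on
    \<open>H\<close>; so the pencil cuts \<open>H\<close> in distinct points.\<close>
  have sep: "K = K'" if "H \<in> B" "K \<in> S" "K' \<in> S" "H \<inter> K \<subseteq> K'" for H K K'
  proof (rule ccontr)
    assume "K \<noteq> K'"
    then have "p = K \<inter> K'"
      using that S pt[of K K'] by (intro proj_point_subset_eq[OF pp]) auto
    moreover have "H \<inter> K = K \<inter> K'"
      using that S B BS[of H K] pt[of K K'] pt[of H K] \<open>K \<noteq> K'\<close> by (intro proj_point_subset_eq) auto
    ultimately show False using B[OF that(1)] by blast
  qed
  \<comment> \<open>Indexes the double points on \<open>H\<close> by the pencil line through
    them.\<close>
  define d where "d H = {K \<in> S. \<forall>L\<in>B. L \<noteq> H \<longrightarrow> \<not> H \<inter> K \<subseteq> L}" for H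
  have d1: "1 \<le> card (d H)" if H: "H \<in> B" for H
  proof -
    obtain K where "K \<in> S" "\<forall>L\<in>\<A>. \<not> p \<subseteq> L \<longrightarrow> L \<noteq> H \<longrightarrow> \<not> H \<inter> K \<subseteq> L"
      using double_point_on_line[OF assms(1) mod B[OF H]] unfolding S_def ..
    then have "K \<in> d H" using B by (simp add: d_def)
    then have "d H \<noteq> {}" by blast
    moreover have "finite (d H)" using finS by (simp add: d_def)
    ultimately show ?thesis by (simp add: Suc_leI card_gt_0_iff)
  qed
  \<comment> \<open>Each non-double intersection on \<open>H\<close> uses up a line of
    \<open>B - {H}\<close>, and different ones use different lines because such a line meets
    \<open>H\<close> once. The additive form avoids truncated subtraction.\<close>
  have d2: "card S + 1 \<le> card (d H) + card B" if H: "H \<in> B" for H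
  proof -
    have "\<forall>K\<in>S - d H. \<exists>L. L \<in> B - {H} \<and> H \<inter> K \<subseteq> L" by (auto simp: d_def)
    then obtain l where l: "\<And>K. K \<in> S - d H \<Longrightarrow> l K \<in> B - {H} \<and> H \<inter> K \<subseteq> l K"
      by (auto simp: bchoice_iff)
    have "inj_on l (S - d H)"
    proof (rule inj_onI)
      fix K K' assume K: "K \<in> S - d H" "K' \<in> S - d H" and eq: "l K = l K'"
      have *: "H \<inter> X = H \<inter> l X" if X: "X \<in> S - d H" for X
        using l[OF X] H X S B BS[of H X] pt[of H X] pt[of H "l X"] by (intro proj_point_subset_eq) auto
      have "H \<inter> K = H \<inter> K'" using *[OF K(1)] *[OF K(2)] eq by simp
      then show "K = K'" using sep[OF H] K by blast
    qed
    then have "card (S - d H) \<le> card (B - {H})"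
      using l finB by (intro card_inj_on_le[of l]) auto
    moreover have "card (S - d H) = card S - card (d H)" "card (d H) \<le> card S"
      using finS by (auto simp: d_def intro!: card_Diff_subset card_mono)
    ultimately show ?thesis using H finB n1 by simp
  qed
  define D where "D = {p \<in> L2 \<A>. mu \<A> p = 1}"
  have finD: "finite D"
  proof (rule finite_subset)
    show "D \<subseteq> (\<lambda>(H, L). H \<inter> L) ` (\<A> \<times> \<A>)" by (auto simp: D_def L2_def)
  qed (use fin in auto)
  have double: "H \<inter> K \<in> D" if H: "H \<in> B" and K: "K \<in> d H" for H K
  proof -
    have K': "K \<in> S" using K by (simp add: d_def)
    have ne: "H \<noteq> K" using B[OF H] S[OF K'] by auto
    have "L = H \<or> L = K" if "L \<in> \<A>" "H \<inter> K \<subseteq> L" for L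
      using that K sep[OF H K'] by (auto simp: d_def B_def)
    then have "lines_through \<A> (H \<inter> K) = {H, K}"
      using S[OF K'] B[OF H] by (auto simp: lines_through_def)
    then have "mu \<A> (H \<inter> K) = 1" using ne by (simp add: mu_def)
    then show ?thesis using pt[of H K] B(1)[OF H] S(1)[OF K'] ne unfolding D_def L2_def by blast
  qed
  \<comment> \<open>No double point is counted twice: it determines its line in \<open>B\<close> by
    the definition of \<open>d\<close>, then its pencil line by \<open>sep\<close>.\<close>
  have "inj_on (\<lambda>(H, K). H \<inter> K) (Sigma B d)"
  proof (rule inj_onI, clarify)
    fix H K H' K'
    assume *: "H \<in> B" "K \<in> d H" "H' \<in> B" "K' \<in> d H'" and eq: "H \<inter> K = H' \<inter> K'"
    have "H = H'" using * eq by (auto simp: d_def)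
    moreover have "K = K'" using sep[of H K K'] * eq by (auto simp: d_def)
    ultimately show "H = H' \<and> K = K'" by simp
  qed
  then have "card (Sigma B d) \<le> card D"
    using double finD by (intro card_inj_on_le[of "\<lambda>(H, K). H \<inter> K"]) auto
  moreover have "card (Sigma B d) = (\<Sum>H\<in>B. card (d H))"
    using finB finS by (intro card_SigmaI) (auto simp: d_def)
  moreover have "card B * max 1 (card S + 1 - card B) \<le> (\<Sum>H\<in>B. card (d H))"
  proof -
    have "max 1 (card S + 1 - card B) \<le> card (d H)" if "H \<in> B" for H
      using d1[OF that] d2[OF that] by simp
    then show ?thesis using sum_bounded_below[of B "max 1 (card S + 1 - card B)" "\<lambda>H. card (d H)"] by simp
  qed
  \<comment> \<open>If \<open>card S = card B + k\<close> with \<open>k > 0\<close>, the maximum is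
    \<open>k + 1\<close>, and \<open>2 * card B * (k + 1)\<close> is at least
    \<open>2 * card B + k\<close>; otherwise the factor 1 suffices.\<close>
  moreover have "card S + card B \<le> 2 * (card B * max 1 (card S + 1 - card B))"
  proof (cases "card S \<le> card B")
    case True
    have "card B * 1 \<le> card B * max 1 (card S + 1 - card B)" by (intro mult_le_mono2) simp
    then show ?thesis using True by linarith
  next
    case False
    then obtain k where k: "card S = card B + k" using less_imp_add_positive by (metis not_le)
    moreover have "k \<le> card B * k" using n1 by simp
    ultimately show ?thesis using n1 by (simp add: algebra_simps)
  qed
  ultimately have "card \<A> \<le> 2 * n2 \<A>" using cardA by (simp add: n2_def D_def)
  then show ?thesis by linarith
qed

end
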